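(* Let $S \subseteq M_n(\mathbb{C})$ be a collection of matrices, and suppose there is a matrix norm $\|\cdot\|$ on $M_n(\mathbb{C})$ such that $\|A\| \leq 1$ for all $A \in S$. Then $\mathrm{HS}(S)$ is contained in the closed unit disc $D=\{z\in\mathbb{C}: |z|\le 1\}$. In particular, $\mathrm{HS}(G) \subseteq D$ for any finite matrix group $G\subseteq GL_n(\mathbb{C})$.
   Context: For a set $S \subseteq M_n(\mathbb{C})$, $\mathrm{Co}(S)$ denotes the set of all (finite) convex combinations of elements of $S$, and the hull spectrum $\mathrm{HS}(S)\subseteq\mathbb{C}$ is the set of all complex numbers that occur as eigenvalues of some matrix in $\mathrm{Co}(S)$. A matrix norm is a submultiplicative norm on $M_n(\mathbb{C})$, i.e. a vector space norm with $\|AB\|\le\|A\|\,\|B\|$ for all $A,B$. *)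

theory Defs
  imports "HOL-Analysis.Analysis" "HOL-Algebra.Group"
begin

text \<open>\<open>M\<^sub>n(\<complex>)\<close> is \<^typ>\<open>complex ^ 'n ^ 'n\<close>, with \<open>n = CARD('n)\<close>.\<close>

definition eigenvalue :: "complex ^ 'n ^ 'n \<Rightarrow> complex \<Rightarrow> bool"
  where "eigenvalue A z \<longleftrightarrow> (\<exists>v. v \<noteq> 0 \<and> A *v v = z *s v)"

text \<open>By \<open>convex_hull_explicit\<close>, \<open>convex hull S\<close> is the set of all finite convex
  combinations of elements of \<open>S\<close>.\<close>

definition hull_spectrum :: "(complex ^ 'n ^ 'n) set \<Rightarrow> complex set"
  where "hull_spectrum S = {z. \<exists>A \<in> convex hull S. eigenvalue A z}"

text \<open>The norm is an arbitrary function \<open>N\<close>, unrelated to the type class operation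
  \<^const>\<open>norm\<close>. No normalisation \<open>N (mat 1) = 1\<close> is required. Complex scalar
  multiplication is spelled out entrywise because \<open>*s\<close> on this type would multiply by
  a row vector.\<close>

definition matrix_norm :: "(complex ^ 'n ^ 'n \<Rightarrow> real) \<Rightarrow> bool"
  where "matrix_norm N \<longleftrightarrow>
    (\<forall>A. 0 \<le> N A) \<and>
    (\<forall>A. N A = 0 \<longleftrightarrow> A = 0) \<and>
    (\<forall>c A. N (\<chi> i j. c * A $ i $ j) = cmod c * N A) \<and>
    (\<forall>A B. N (A + B) \<le> N A + N B) \<and>
    (\<forall>A B. N (A ** B) \<le> N A * N B)"

definition GL :: "(complex ^ 'n ^ 'n) monoid"
  where "GL = \<lparr>carrier = {A. invertible A}, mult = (**), one = mat 1\<rparr>"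

lemma group_GL: "group (GL :: (complex ^ 'n ^ 'n) monoid)"
proof (rule groupI)
  fix A :: "complex ^ 'n ^ 'n"
  assume "A \<in> carrier GL"
  then obtain B where "A ** B = mat 1" "B ** A = mat 1"
    by (auto simp: GL_def invertible_def)
  then show "\<exists>B \<in> carrier GL. B \<otimes>\<^bsub>GL\<^esub> A = \<one>\<^bsub>GL\<^esub>"
    by (auto simp: GL_def invertible_def)
next
  show "\<one>\<^bsub>GL\<^esub> \<in> carrier (GL :: (complex ^ 'n ^ 'n) monoid)"
    by (auto simp: GL_def invertible_def intro!: exI[of _ "mat 1"])
qed (auto simp: GL_def matrix_mul_assoc intro: invertible_mult)

end

theory Submission
  imports Defs
begin

text \<open>If the vectors carry a norm \<open>p\<close> under which every matrix of \<open>S\<close> is a contraction, then so is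
  every matrix of the convex hull, and a contraction has its eigenvalues in the unit disc. A matrix
  norm \<open>N\<close> with \<open>N \<le> 1\<close> on \<open>S\<close> yields such a \<open>p\<close>: let \<open>p v\<close> be the norm of the matrix all of whose
  columns are \<open>v\<close>. For a finite group, sum the Euclidean norm over the orbit of \<open>v\<close>.\<close>

lemma norm_vector_scalar_mult: "norm (c *s (v :: complex ^ 'n)) = cmod c * norm v"
  by (simp add: norm_vec_def norm_mult L2_set_right_distrib)

text \<open>Convex combinations use real scalars, whereas the homogeneity of \<open>p\<close> below
  is stated for complex ones; this equation bridges the two.\<close>

lemma scaleR_matrix_vector_mult:
  fixes A :: "complex ^ 'n ^ 'm"
  shows "(r *\<^sub>R A) *v v = complex_of_real r *s (A *v v)"
  by (simp add: vec_eq_iff matrix_vector_mult_def scaleR_conv_of_real[where 'a = complex]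
      sum_distrib_left mult.assoc)

lemma hull_spectrum_contractions:
  fixes S :: "(complex ^ 'n ^ 'n) set" and p :: "complex ^ 'n \<Rightarrow> real"
  assumes pos: "\<And>v. v \<noteq> 0 \<Longrightarrow> 0 < p v"
    and scale: "\<And>c v. p (c *s v) = cmod c * p v"
    and triangle: "\<And>v w. p (v + w) \<le> p v + p w"
    and contraction: "\<And>A v. A \<in> S \<Longrightarrow> p (A *v v) \<le> p v"
  shows "hull_spectrum S \<subseteq> {z. cmod z \<le> 1}"
proof
  fix z
  assume "z \<in> hull_spectrum S"
  then obtain A v where A: "A \<in> convex hull S" and v: "v \<noteq> 0" and eig: "A *v v = z *s v"
    by (auto simp: hull_spectrum_def eigenvalue_def)
  \<comment> \<open>With the eigenvector \<open>v\<close> fixed, \<open>B *v v\<close> is linear in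
    \<open>B\<close>, so the bound \<open>p v\<close> survives convex combinations. The hull of
    \<open>S\<close> is the least convex set containing \<open>S\<close>, hence the bound reaches
    \<open>A\<close>.\<close>
  have "convex {B. p (B *v v) \<le> p v}"
  proof (rule convexI)
    fix B C :: "complex ^ 'n ^ 'n" and s t :: real
    assume B: "B \<in> {B. p (B *v v) \<le> p v}" and C: "C \<in> {B. p (B *v v) \<le> p v}"
      and st: "0 \<le> s" "0 \<le> t" "s + t = 1"
    have "p ((s *\<^sub>R B + t *\<^sub>R C) *v v) \<le> s * p (B *v v) + t * p (C *v v)"
      using triangle[of "complex_of_real s *s (B *v v)" "complex_of_real t *s (C *v v)"] st
      by (simp add: matrix_vector_mult_add_rdistrib scaleR_matrix_vector_mult scale)
    also have "\<dots> \<le> p v"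
      using B C st by (intro convex_bound_le) auto
    finally show "s *\<^sub>R B + t *\<^sub>R C \<in> {B. p (B *v v) \<le> p v}" by simp
  qed
  then have "convex hull S \<subseteq> {B. p (B *v v) \<le> p v}"
    by (intro hull_minimal) (auto intro: contraction)
  \<comment> \<open>The eigenvalue equation turns the bound for \<open>A\<close> into this
    inequality, and the positive factor \<open>p v\<close> cancels.\<close>
  with A have "cmod z * p v \<le> p v"
    by (auto simp: eig scale)
  with pos[OF v] show "z \<in> {z. cmod z \<le> 1}" by simp
qed

lemma hull_spectrum_matrix_norm:
  fixes S :: "(complex ^ 'n ^ 'n) set"
  assumes N: "matrix_norm N" and le: "\<And>A. A \<in> S \<Longrightarrow> N A \<le> 1"
  shows "hull_spectrum S \<subseteq> {z. cmod z \<le> 1}"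
proof -
  define col :: "complex ^ 'n \<Rightarrow> complex ^ 'n ^ 'n" where "col v = (\<chi> i j. v $ i)" for v
  have nonneg: "0 \<le> N A" and zero: "N A = 0 \<longleftrightarrow> A = 0"
    and scale: "N (\<chi> i j. c * A $ i $ j) = cmod c * N A"
    and triangle: "N (A + B) \<le> N A + N B" and mult: "N (A ** B) \<le> N A * N B" for c A B
    using N by (auto simp: matrix_norm_def)
  show ?thesis
  proof (rule hull_spectrum_contractions[where p = "\<lambda>v. N (col v)"])
    fix v :: "complex ^ 'n"
    assume "v \<noteq> 0"
    then have "col v \<noteq> 0" by (simp add: col_def vec_eq_iff)
    then show "0 < N (col v)" using nonneg[of "col v"] zero[of "col v"] by linarith
  next
    fix c and v :: "complex ^ 'n"
    show "N (col (c *s v)) = cmod c * N (col v)"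
      using scale[of c "col v"] by (simp add: col_def)
  next
    fix v w :: "complex ^ 'n"
    have "col (v + w) = col v + col w" by (simp add: col_def vec_eq_iff)
    then show "N (col (v + w)) \<le> N (col v) + N (col w)" by (simp add: triangle)
  next
    fix A and v :: "complex ^ 'n"
    assume "A \<in> S"
    \<comment> \<open>Left multiplication acts on each column separately, so submultiplicativity of
      \<open>N\<close> controls the action of \<open>A\<close> on vectors.\<close>
    have "col (A *v v) = A ** col v"
      by (simp add: col_def vec_eq_iff matrix_vector_mult_def matrix_matrix_mult_def)
    then have "N (col (A *v v)) \<le> N A * N (col v)" by (simp add: mult)
    also have "\<dots> \<le> N (col v)"
      using le[OF \<open>A \<in> S\<close>] nonneg by (intro mult_left_le_one_le) auto
    finally show "N (col (A *v v)) \<le> N (col v)" .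
  qed
qed

lemma hull_spectrum_finite_subgroup:
  fixes G :: "(complex ^ 'n ^ 'n) set"
  assumes G: "subgroup G GL" and fin: "finite G"
  shows "hull_spectrum G \<subseteq> {z. cmod z \<le> 1}"
proof (rule hull_spectrum_contractions[where p = "\<lambda>v. \<Sum>B\<in>G. norm (B *v v)"])
  fix v :: "complex ^ 'n"
  assume "v \<noteq> 0"
  \<comment> \<open>The identity contributes the summand \<open>norm v\<close>, which makes the sum
    positive.\<close>
  moreover have "mat 1 \<in> G"
    using subgroup.one_closed[OF G] by (simp add: GL_def)
  ultimately show "0 < (\<Sum>B\<in>G. norm (B *v v))"
    using fin by (intro sum_pos2[of _ "mat 1"]) auto
next
  fix c and v :: "complex ^ 'n"
  show "(\<Sum>B\<in>G. norm (B *v (c *s v))) = cmod c * (\<Sum>B\<in>G. norm (B *v v))"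
    by (simp add: vector_scalar_commute norm_vector_scalar_mult sum_distrib_left)
next
  fix v w :: "complex ^ 'n"
  show "(\<Sum>B\<in>G. norm (B *v (v + w))) \<le> (\<Sum>B\<in>G. norm (B *v v)) + (\<Sum>B\<in>G. norm (B *v w))"
    by (simp add: matrix_vector_right_distrib norm_triangle_ineq sum_mono flip: sum.distrib)
next
  fix A and v :: "complex ^ 'n"
  assume A: "A \<in> G"
  \<comment> \<open>Right multiplication by \<open>A\<close> maps \<open>G\<close> injectively into
    itself, so the sum for \<open>A *v v\<close> is a sum of the nonnegative terms
    \<open>norm (B *v v)\<close> over distinct elements of \<open>G\<close>.\<close>
  have closed: "(\<lambda>B. B ** A) ` G \<subseteq> G"
    using subgroup.m_closed[OF G _ A] by (auto simp: GL_def)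
  obtain A' where "A ** A' = mat 1"
    using subgroup.subset[OF G] A by (auto simp: GL_def invertible_def)
  then have inj: "inj_on (\<lambda>B. B ** A) G"
    by (intro inj_on_inverseI[where g = "\<lambda>B. B ** A'"]) (simp flip: matrix_mul_assoc)
  have "(\<Sum>B\<in>G. norm (B *v (A *v v))) = (\<Sum>B\<in>(\<lambda>B. B ** A) ` G. norm (B *v v))"
    by (simp add: sum.reindex[OF inj] matrix_vector_mul_assoc)
  also have "\<dots> \<le> (\<Sum>B\<in>G. norm (B *v v))"
    using fin closed by (intro sum_mono2) auto
  finally show "(\<Sum>B\<in>G. norm (B *v (A *v v))) \<le> (\<Sum>B\<in>G. norm (B *v v))" .
qed

theorem lemma2p9:
  shows "(\<forall>S :: (complex ^ 'n ^ 'n) set.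
            (\<exists>N. matrix_norm N \<and> (\<forall>A \<in> S. N A \<le> 1)) \<longrightarrow>
            hull_spectrum S \<subseteq> {z. cmod z \<le> 1}) \<and>
         (\<forall>G :: (complex ^ 'n ^ 'n) set.
            subgroup G GL \<and> finite G \<longrightarrow> hull_spectrum G \<subseteq> {z. cmod z \<le> 1})"
  using hull_spectrum_matrix_norm hull_spectrum_finite_subgroup by metis

end
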